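(* Let $n\ge1$, $w\in\mathbb{R}^n_{>0}$, $1/2\le\beta<1$, $0<\epsilon\le1$, $c_0\in\mathbb{R}^n$, $r_0>0$, $x^*\in\mathcal{B}(c_0,r_0w)$ and $f\in\mathcal{D}_\epsilon\bigl(x^*,\mathcal{B}(c_0,r_0w)\bigr)$. Run Cube-Freeze$(\beta,w,\epsilon)$ from the initial box $\mathcal{B}(c_0,r_0w)$. Then for all $k$ and $i$ $$|c_{k,i}-x_i^*|\le r_{k,i},\qquad r_{k,i}=\beta^{m_i(k)}r_0w_i,$$ where $m_i(k)=\#\{j<k:\ i\in S_j\}$ is the number of activations of coordinate $i$. Consequently $$M_k\le\beta^{\min_im_i(k)}r_0,$$ and if every coordinate is activated in at least a fraction $\nu$ of the steps (i.e. $m_i(k)\ge\nu k$ for all $i$), then $M_k\le\beta^{\nu k}r_0$.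
   Context: $\mathcal{B}(c,r)=\{x:|x_i-c_i|\le r_i\ \forall i\}$; $M_k=\max_i|c_{k,i}-x_i^*|/w_i$; $[n]=\{1,\dots,n\}$. Cube-Freeze$(\beta,w,\epsilon)$: start with centre $c_0$ and half-sizes $r_{0,i}=r_0w_i$. At step $k$ form the active set $S_k=\{i:\ |\partial_if(c_k)|\ge\epsilon\|\nabla f(c_k)\|_\infty\}$ (so $S_k=[n]$ if $\nabla f(c_k)=0$). For $i\in S_k$: $c_{k+1,i}=c_{k,i}-(1-\beta)r_{k,i}s_{k,i}$ and $r_{k+1,i}=\beta r_{k,i}$, where $s_{k,i}=\operatorname{sign}\partial_if(c_k)$ if $\partial_if(c_k)\ne0$ and $s_{k,i}\in\{-1,+1\}$ is arbitrary otherwise. For $i\notin S_k$: $c_{k+1,i}=c_{k,i}$, $r_{k+1,i}=r_{k,i}$. Class $\mathcal{D}_\epsilon(x^*,B)$: functions $f$ differentiable on a neighbourhood of $B$ such that for all $x\in B$ and $i\in[n]$, if $|\partial_if(x)|\ge\epsilon\|\nabla f(x)\|_\infty$ and $x_i\ne x_i^*$, then $\partial_if(x)(x_i-x_i^* )>0$. *)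

theory Defs
  imports "HOL-Analysis.Analysis"
begin

definition weighted_box :: "real^'n \<Rightarrow> real^'n \<Rightarrow> (real^'n) set" where
  "weighted_box c r = {x. \<forall>i. \<bar>x $ i - c $ i\<bar> \<le> r $ i}"

definition partial_deriv :: "'n \<Rightarrow> (real^'n \<Rightarrow> real) \<Rightarrow> real^'n \<Rightarrow> real" where
  "partial_deriv i f x = deriv (\<lambda>t. f (x + t *\<^sub>R axis i 1)) 0"

definition grad :: "(real^'n \<Rightarrow> real) \<Rightarrow> real^'n \<Rightarrow> real^'n" where
  "grad f x = (\<chi> i. partial_deriv i f x)"

definition active_set :: "real \<Rightarrow> (real^'n \<Rightarrow> real) \<Rightarrow> real^'n \<Rightarrow> 'n set" where
  "active_set \<epsilon> f x = {i. \<bar>partial_deriv i f x\<bar> \<ge> \<epsilon> * infnorm (grad f x)}"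

definition class_D :: "real \<Rightarrow> real^'n \<Rightarrow> (real^'n) set \<Rightarrow> (real^'n \<Rightarrow> real) set" where
  "class_D \<epsilon> xs B = {f.
     (\<exists>U. open U \<and> B \<subseteq> U \<and> f differentiable_on U) \<and>
     (\<forall>x\<in>B. \<forall>i. \<bar>partial_deriv i f x\<bar> \<ge> \<epsilon> * infnorm (grad f x) \<and> x $ i \<noteq> xs $ i
        \<longrightarrow> partial_deriv i f x * (x $ i - xs $ i) > 0)}"

text \<open>The algorithm is nondeterministic, since the sign used for an active coordinate with
  vanishing partial derivative is arbitrary. A step is therefore a relation between
  (centre, half-sizes) pairs, and a run is any pair of sequences compatible with it.\<close>

definition cube_freeze_step ::
  "real \<Rightarrow> real \<Rightarrow> (real^'n \<Rightarrow> real) \<Rightarrow> real^'n \<Rightarrow> real^'n \<Rightarrow> real^'n \<Rightarrow> real^'n \<Rightarrow> bool" where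
  "cube_freeze_step \<beta> \<epsilon> f c r c' r' \<longleftrightarrow>
     (\<exists>s :: 'n \<Rightarrow> real.
        (\<forall>i\<in>active_set \<epsilon> f c.
           (if partial_deriv i f c \<noteq> 0 then s i = sgn (partial_deriv i f c) else s i \<in> {-1, 1}) \<and>
           c' $ i = c $ i - (1 - \<beta>) * r $ i * s i \<and>
           r' $ i = \<beta> * r $ i) \<and>
        (\<forall>i. i \<notin> active_set \<epsilon> f c \<longrightarrow> c' $ i = c $ i \<and> r' $ i = r $ i))"

definition cube_freeze_run ::
  "real \<Rightarrow> real^'n \<Rightarrow> real \<Rightarrow> (real^'n \<Rightarrow> real) \<Rightarrow> real^'n \<Rightarrow> real \<Rightarrow>
     (nat \<Rightarrow> real^'n) \<Rightarrow> (nat \<Rightarrow> real^'n) \<Rightarrow> bool" where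
  "cube_freeze_run \<beta> w \<epsilon> f c0 r0 c r \<longleftrightarrow>
     c 0 = c0 \<and> r 0 = r0 *\<^sub>R w \<and>
     (\<forall>k. cube_freeze_step \<beta> \<epsilon> f (c k) (r k) (c (Suc k)) (r (Suc k)))"

definition activations :: "real \<Rightarrow> (real^'n \<Rightarrow> real) \<Rightarrow> (nat \<Rightarrow> real^'n) \<Rightarrow> 'n \<Rightarrow> nat \<Rightarrow> nat" where
  "activations \<epsilon> f c i k = card {j. j < k \<and> i \<in> active_set \<epsilon> f (c j)}"

definition weighted_error :: "real^'n \<Rightarrow> real^'n \<Rightarrow> real^'n \<Rightarrow> real" where
  "weighted_error w xs c = (MAX i. \<bar>c $ i - xs $ i\<bar> / w $ i)"

end

theory Submission
  imports Defs
begin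

text \<open>
  The box \<open>weighted_box (c k) (r k)\<close> is a certificate for the location of the target \<open>xs\<close>, and
  each active coordinate replaces its interval by the fraction \<open>\<beta>\<close> of it that lies on the descent
  side. If the centre differs from \<open>xs\<close> in an active coordinate, the sign of the partial derivative
  points away from \<open>xs\<close>, so the target survives in that part; if the centre agrees with \<open>xs\<close> in
  that coordinate, either sign may occur, and the target survives because \<open>\<beta> \<ge> 1/2\<close>
  makes both parts contain the old centre (lemma \<open>interval_shrink_keeps_target\<close>).

  The sign condition of the class is available only inside the initial box, so the centres have to
  stay there. They do because a step moves a coordinate of the centre by exactly the amount by which
  it shortens the half-size: the shrunken interval lies in the old one, so distance travelled plus
  current half-size never exceeds the initial half-size. This gives lemma \<open>centre_stays\<close>, and
  with it lemma \<open>step_keeps_target\<close> applies at every step.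

  The bounds on the weighted error then follow by comparing powers of \<open>\<beta> < 1\<close>.
\<close>

text \<open>Here \<open>d\<close> is the offset of the centre from the target, \<open>p\<close> the partial derivative and \<open>s\<close> the
  chosen sign. For \<open>d \<noteq> 0\<close> the step goes towards the target by \<open>(1 - \<beta>) * \<rho>\<close>: undershooting
  leaves at most \<open>\<rho> - (1 - \<beta>) * \<rho> = \<beta> * \<rho>\<close>, while overshooting, like leaving the target when
  \<open>d = 0\<close>, costs at most \<open>(1 - \<beta>) * \<rho> \<le> \<beta> * \<rho>\<close>.\<close>

lemma interval_shrink_keeps_target:
  fixes d p s \<beta> \<rho> :: real
  assumes d: "\<bar>d\<bar> \<le> \<rho>"
    and outward: "d \<noteq> 0 \<Longrightarrow> p * d > 0"
    and sign: "if p \<noteq> 0 then s = sgn p else s \<in> {-1, 1}"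
    and \<beta>: "1 / 2 \<le> \<beta>"
  shows "\<bar>d - (1 - \<beta>) * \<rho> * s\<bar> \<le> \<beta> * \<rho>"
proof -
  have "0 \<le> \<rho>" using d by linarith
  then have "(1 - \<beta>) * \<rho> \<le> \<beta> * \<rho>" and "0 \<le> \<beta> * \<rho>"
    using \<beta> by (auto intro!: mult_right_mono)
  moreover have "(1 - \<beta>) * \<rho> = \<rho> - \<beta> * \<rho>" by (simp add: algebra_simps)
  moreover have "s = 1 \<and> 0 \<le> d \<or> s = - 1 \<and> d \<le> 0"
    using outward sign
    by (cases "d = 0") (auto simp: sgn_if zero_less_mult_iff split: if_splits)
  ultimately show ?thesis using d by (elim disjE) auto
qed

lemma activations_0: "activations \<epsilon> f c i 0 = 0"
  by (simp add: activations_def)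

lemma activations_Suc:
  "activations \<epsilon> f c i (Suc k) =
     activations \<epsilon> f c i k + (if i \<in> active_set \<epsilon> f (c k) then 1 else 0)"
proof -
  have "{j. j < Suc k \<and> i \<in> active_set \<epsilon> f (c j)} =
      (if i \<in> active_set \<epsilon> f (c k)
       then insert k {j. j < k \<and> i \<in> active_set \<epsilon> f (c j)}
       else {j. j < k \<and> i \<in> active_set \<epsilon> f (c j)})"
    by (auto simp: less_Suc_eq)
  then show ?thesis by (simp add: activations_def)
qed

lemma run_half_size:
  assumes "cube_freeze_run \<beta> w \<epsilon> f c0 r0 c r"
  shows "r k $ i = \<beta> ^ activations \<epsilon> f c i k * r0 * w $ i"
proof (induction k)
  case 0
  then show ?case using assms by (simp add: cube_freeze_run_def activations_0)
next
  case (Suc k)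
  have "cube_freeze_step \<beta> \<epsilon> f (c k) (r k) (c (Suc k)) (r (Suc k))"
    using assms by (simp add: cube_freeze_run_def)
  then have "r (Suc k) $ i = (if i \<in> active_set \<epsilon> f (c k) then \<beta> else 1) * r k $ i"
    by (auto simp: cube_freeze_step_def)
  then show ?case using Suc.IH by (simp add: activations_Suc)
qed

text \<open>The shrunken interval shares an endpoint with the old one, so the quantity
  \<open>\<bar>c $ i - c0 $ i\<bar> + r $ i\<close> does not increase.\<close>

lemma step_travel_le:
  assumes step: "cube_freeze_step \<beta> \<epsilon> f c r c' r'"
    and "\<beta> \<le> 1" and "0 \<le> r $ i"
  shows "\<bar>c' $ i - a\<bar> + r' $ i \<le> \<bar>c $ i - a\<bar> + r $ i"
proof (cases "i \<in> active_set \<epsilon> f c")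
  case True
  then obtain s :: real where s: "\<bar>s\<bar> = 1"
    and c': "c' $ i = c $ i - (1 - \<beta>) * r $ i * s" and r': "r' $ i = \<beta> * r $ i"
    using step unfolding cube_freeze_step_def
    by (metis abs_minus_cancel abs_one abs_sgn_eq empty_iff insert_iff)
  have "\<bar>c' $ i - c $ i\<bar> = (1 - \<beta>) * r $ i"
    using s assms(2,3) by (simp add: c' abs_mult)
  then show ?thesis by (simp add: r' algebra_simps)
next
  case False
  then show ?thesis using step by (simp add: cube_freeze_step_def)
qed

lemma centre_stays:
  assumes run: "cube_freeze_run \<beta> w \<epsilon> f c0 r0 c r"
    and \<beta>: "0 \<le> \<beta>" "\<beta> \<le> 1" and "0 \<le> r0" and "\<forall>i. 0 \<le> w $ i"
  shows "c k \<in> weighted_box c0 (r0 *\<^sub>R w)"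
proof -
  have nonneg: "0 \<le> r k $ i" for k i
    using assms by (simp add: run_half_size[OF run])
  have "\<bar>c k $ i - c0 $ i\<bar> + r k $ i \<le> r0 * w $ i" for i
  proof (induction k)
    case 0
    then show ?case using run by (simp add: cube_freeze_run_def)
  next
    case (Suc k)
    have "cube_freeze_step \<beta> \<epsilon> f (c k) (r k) (c (Suc k)) (r (Suc k))"
      using run by (simp add: cube_freeze_run_def)
    from step_travel_le[OF this \<beta>(2) nonneg] Suc.IH show ?case by (rule order_trans)
  qed
  then show ?thesis using nonneg by (auto simp: weighted_box_def) (smt (verit))
qed

lemma step_keeps_target:
  assumes step: "cube_freeze_step \<beta> \<epsilon> f c r c' r'"
    and f: "f \<in> class_D \<epsilon> xs B" and c: "c \<in> B"
    and \<beta>: "1 / 2 \<le> \<beta>" and near: "\<bar>c $ i - xs $ i\<bar> \<le> r $ i"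
  shows "\<bar>c' $ i - xs $ i\<bar> \<le> r' $ i"
proof (cases "i \<in> active_set \<epsilon> f c")
  case True
  then obtain s :: real
    where sign: "if partial_deriv i f c \<noteq> 0 then s = sgn (partial_deriv i f c) else s \<in> {-1, 1}"
    and c': "c' $ i = c $ i - (1 - \<beta>) * r $ i * s" and r': "r' $ i = \<beta> * r $ i"
    using step unfolding cube_freeze_step_def by blast
  have "partial_deriv i f c * (c $ i - xs $ i) > 0" if "c $ i - xs $ i \<noteq> 0"
    using f c True that by (auto simp: class_D_def active_set_def)
  from interval_shrink_keeps_target[OF near this sign \<beta>]
  show ?thesis by (simp add: c' r' algebra_simps)
next
  case False
  then show ?thesis using step near by (simp add: cube_freeze_step_def)
qed

lemma weighted_error_le:
  fixes w xs c :: "real^'n"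
  assumes "\<And>i. 0 < w $ i" and "\<And>i. \<bar>c $ i - xs $ i\<bar> \<le> q * w $ i"
  shows "weighted_error w xs c \<le> q"
  using assms by (auto simp: weighted_error_def pos_divide_le_eq)

theorem theoremE3:
  fixes w c0 xs :: "real^'n"
    and \<beta> \<epsilon> r0 :: real
    and f :: "real^'n \<Rightarrow> real"
    and c r :: "nat \<Rightarrow> real^'n"
  assumes "\<forall>i. 0 < w $ i"
    and "1 / 2 \<le> \<beta>" and "\<beta> < 1"
    and "0 < \<epsilon>" and "\<epsilon> \<le> 1"
    and "0 < r0"
    and "xs \<in> weighted_box c0 (r0 *\<^sub>R w)"
    and "f \<in> class_D \<epsilon> xs (weighted_box c0 (r0 *\<^sub>R w))"
    and "cube_freeze_run \<beta> w \<epsilon> f c0 r0 c r"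
  shows "(\<forall>k i. \<bar>c k $ i - xs $ i\<bar> \<le> r k $ i \<and>
                r k $ i = \<beta> ^ activations \<epsilon> f c i k * r0 * w $ i) \<and>
         (\<forall>k. weighted_error w xs (c k) \<le> \<beta> ^ (MIN i. activations \<epsilon> f c i k) * r0) \<and>
         (\<forall>(\<nu>::real) k. (\<forall>i. real (activations \<epsilon> f c i k) \<ge> \<nu> * real k) \<longrightarrow>
                weighted_error w xs (c k) \<le> \<beta> powr (\<nu> * real k) * r0)"
proof -
  note run = assms(9)
  have \<beta>: "0 < \<beta>" "\<beta> \<le> 1" using assms(2,3) by auto
  have rk: "r k $ i = \<beta> ^ activations \<epsilon> f c i k * r0 * w $ i" for k i
    by (rule run_half_size[OF run])
  have inside: "c k \<in> weighted_box c0 (r0 *\<^sub>R w)" for k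
    using centre_stays[OF run] \<beta> assms(1,6) by (simp add: less_imp_le)
  have near: "\<bar>c k $ i - xs $ i\<bar> \<le> r k $ i" for k i
  proof (induction k)
    case 0
    then show ?case
      using run assms(7) by (simp add: cube_freeze_run_def weighted_box_def abs_minus_commute)
  next
    case (Suc k)
    have "cube_freeze_step \<beta> \<epsilon> f (c k) (r k) (c (Suc k)) (r (Suc k))"
      using run by (simp add: cube_freeze_run_def)
    then show ?case using assms(8) inside assms(2) Suc.IH by (rule step_keeps_target)
  qed
  have error: "weighted_error w xs (c k) \<le> q * r0"
    if q: "\<And>i. \<beta> ^ activations \<epsilon> f c i k \<le> q" for k q
  proof (rule weighted_error_le)
    fix i
    show "0 < w $ i" using assms(1) by simp
    have "r k $ i \<le> q * r0 * w $ i"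
      unfolding rk using q assms(1,6) by (intro mult_right_mono) (auto intro: less_imp_le)
    with near show "\<bar>c k $ i - xs $ i\<bar> \<le> q * r0 * w $ i" by (rule order_trans)
  qed
  have "weighted_error w xs (c k) \<le> \<beta> ^ (MIN i. activations \<epsilon> f c i k) * r0" for k
    using \<beta> by (intro error power_decreasing) auto
  moreover have "weighted_error w xs (c k) \<le> \<beta> powr (\<nu> * real k) * r0"
    if "\<forall>i. real (activations \<epsilon> f c i k) \<ge> \<nu> * real k" for \<nu> k
  proof (rule error)
    fix i
    have "\<beta> ^ activations \<epsilon> f c i k = \<beta> powr real (activations \<epsilon> f c i k)"
      using \<beta> by (simp add: powr_realpow)
    also have "\<dots> \<le> \<beta> powr (\<nu> * real k)"
      using that \<beta> by (intro powr_mono') auto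
    finally show "\<beta> ^ activations \<epsilon> f c i k \<le> \<beta> powr (\<nu> * real k)" .
  qed
  ultimately show ?thesis using near rk by blast
qed

end
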